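(* Let $X$ be an approach space with approach system $\mathcal{A}=(\mathcal{A}_x)_{x\in X}$, and suppose that $X$ is locally countably generated. Then for every set $A\subset X$: (i) $\chi_{rsc}(A)\le \chi_{rc}(A)\le \chi_{rsc}(A)+\chi_L(X)$; (ii) in particular, if $\chi_L(X)=0$, then $\chi_{rsc}(A)=\chi_{rc}(A)$; (iii) if $\chi_L(X)=0$ and, in addition, $X$ is sequentially complete, then $A$ is relatively sequentially compact (in the topological coreflection of $X$) if and only if $\chi_{rsc}(A)=0$.
   Context: **Approach systems.** An approach system on a set $X$ is a family $\mathcal{A}=(\mathcal{A}_x)_{x\in X}$ where each $\mathcal{A}_x$ is a nonempty collection of functions $X\to[0,\infty]$, closed under finite pointwise maxima and under passing to pointwise smaller functions, such that for all $x\in X$: (A1) $\phi(x)=0$ for all $\phi\in\mathcal{A}_x$; (A2) if $\psi:X\to[0,\infty]$ is such that for all $\epsilon>0$ and $N<\infty$ there is $\phi\in\mathcal{A}_x$ with $\min(\psi,N)\le\phi+\epsilon$ pointwise, then $\psi\in\mathcal{A}_x$; (A3) for all $\phi\in\mathcal{A}_x$ and $N<\infty$ there is $(\phi_z)_{z\in X}\in\prod_{z\in X}\mathcal{A}_z$ with $\min(\phi(y),N)\le\phi_x(z)+\phi_z(y)$ for all $y,z\in X$. An approach space is a set with an approach system. **Basis.** A family $(\mathcal{B}_x)_{x\in X}$ of nonempty sets of functions $X\to[0,\infty]$ is a basis for $\mathcal{A}$ if each $\mathcal{B}_x$ is upward directed (for $\alpha,\beta\in\mathcal{B}_x$ there is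 $\gamma\in\mathcal{B}_x$ with $\max(\alpha,\beta)\le\gamma$) and $\mathcal{A}_x$ is exactly the set of $\psi:X\to[0,\infty]$ such that for all $\epsilon>0$, $N<\infty$ there is $\phi\in\mathcal{B}_x$ with $\min(\psi,N)\le\phi+\epsilon$. $X$ is locally countably generated if $\mathcal{A}$ has a basis $(\mathcal{B}_x)_x$ with every $\mathcal{B}_x$ countable. **Balls and convergence.** For $x\in X$, $\phi\in\mathcal{A}_x$, $\epsilon>0$ put $B_\phi(x,\epsilon)=\{y\in X\mid\phi(y)<\epsilon\}$ (a ball with center $x$ and radius $\epsilon$). The topological coreflection is the topology on $X$ in which the sets $B_\phi(x,\epsilon)$ ($\phi\in\mathcal{A}_x$, $\epsilon>0$) form a neighbourhood base at $x$. A sequence $(x_n)_n$ is $\epsilon$-convergent to $x$ if for every $\phi\in\mathcal{A}_x$ one has $x_n\in B_\phi(x,\epsilon)$ for all sufficiently large $n$; it is $\epsilon$-convergent if it is $\epsilon$-convergent to some $x\in X$. Put $\lambda(x_n\to x)=\inf\{\alpha>0\mid (x_n)_n \text{ is } \alpha\text{-convergent to } x\}$. Throughout, $\inf\emptyset=\infty$. **Sequential completeness.** $X$ is sequentially complete if for every sequence $(x_n)_n$ in $X$, $\inf_{x\in X}\lambda(x_n\to x)=0$ implies that $(x_n)_n$ converges to some point of $X$ in the topological coreflection. **Indices.** $A\subset X$ is $\epsilon$-relatively sequentially compact if every sequence in $A$ has an $\epsilon$-convergent subsequence (limit point in $X$); $\chi_{rsc}(A)=\inf\{\alpha>0\mid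 A \text{ is }\alpha\text{-relatively sequentially compact}\}$. For $\Phi=(\phi_x)_x\in\prod_{x\in X}\mathcal{A}_x$, a $\Phi$-ball with radius $\epsilon$ is a set of the form $B_{\phi_x}(x,\epsilon)$, $x\in X$. $A$ is $\epsilon$-relatively compact if for every $\Phi\in\prod_{x\in X}\mathcal{A}_x$ the set $A$ can be covered with finitely many $\Phi$-balls with radius $\epsilon$; $\chi_{rc}(A)=\inf\{\alpha>0\mid A\text{ is }\alpha\text{-relatively compact}\}$. $X$ is $\epsilon$-Lindelöf if for every $\Phi\in\prod_{x\in X}\mathcal{A}_x$ the space $X$ can be covered with countably many $\Phi$-balls with radius $\epsilon$; $\chi_L(X)=\inf\{\alpha>0\mid X\text{ is }\alpha\text{-Lindelöf}\}$. $A$ is relatively sequentially compact if every sequence in $A$ has a subsequence converging, in the topological coreflection, to a point of $X$. *)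

theory Defs
  imports "HOL-Analysis.Analysis"
begin

text \<open>
  The underlying set is an explicit carrier X (possibly empty). Functions from X to [0, \<infinity>] are
  the elements of \<open>X \<rightarrow>\<^sub>E UNIV\<close>, that is, functions into \<open>ennreal\<close> with a fixed value
  \<open>undefined\<close> off X, so that equality of such functions is equality on X.
\<close>

abbreviation appr_funs :: "'a set \<Rightarrow> ('a \<Rightarrow> ennreal) set" where
  "appr_funs X \<equiv> X \<rightarrow>\<^sub>E (UNIV :: ennreal set)"

definition dominated_by :: "'a set \<Rightarrow> ('a \<Rightarrow> ennreal) set \<Rightarrow> ('a \<Rightarrow> ennreal) \<Rightarrow> bool" where
  "dominated_by X \<B> \<psi> \<longleftrightarrow>
     (\<forall>\<epsilon>::real. \<forall>N::ennreal. 0 < \<epsilon> \<longrightarrow> N < \<infinity> \<longrightarrow>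
        (\<exists>\<phi>\<in>\<B>. \<forall>y\<in>X. min (\<psi> y) N \<le> \<phi> y + ennreal \<epsilon>))"

locale approach_space =
  fixes X :: "'a set" and \<A> :: "'a \<Rightarrow> ('a \<Rightarrow> ennreal) set"
  assumes funs: "x \<in> X \<Longrightarrow> \<A> x \<subseteq> appr_funs X"
    and nonempty: "x \<in> X \<Longrightarrow> \<A> x \<noteq> {}"
    and max_closed: "\<lbrakk>x \<in> X; \<phi> \<in> \<A> x; \<psi> \<in> \<A> x\<rbrakk> \<Longrightarrow> (\<lambda>y\<in>X. max (\<phi> y) (\<psi> y)) \<in> \<A> x"
    and down_closed: "\<lbrakk>x \<in> X; \<phi> \<in> \<A> x; \<psi> \<in> appr_funs X; \<And>y. y \<in> X \<Longrightarrow> \<psi> y \<le> \<phi> y\<rbrakk> \<Longrightarrow> \<psi> \<in> \<A> x"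
    and A1: "\<lbrakk>x \<in> X; \<phi> \<in> \<A> x\<rbrakk> \<Longrightarrow> \<phi> x = 0"
    and A2: "\<lbrakk>x \<in> X; \<psi> \<in> appr_funs X; dominated_by X (\<A> x) \<psi>\<rbrakk> \<Longrightarrow> \<psi> \<in> \<A> x"
    and A3: "\<lbrakk>x \<in> X; \<phi> \<in> \<A> x; N < \<infinity>\<rbrakk> \<Longrightarrow>
               \<exists>\<Phi>\<in>Pi X \<A>. \<forall>y\<in>X. \<forall>z\<in>X. min (\<phi> y) N \<le> \<Phi> x z + \<Phi> z y"

definition approach_basis ::
    "'a set \<Rightarrow> ('a \<Rightarrow> ('a \<Rightarrow> ennreal) set) \<Rightarrow> ('a \<Rightarrow> ('a \<Rightarrow> ennreal) set) \<Rightarrow> bool" where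
  "approach_basis X \<A> \<B> \<longleftrightarrow>
     (\<forall>x\<in>X. \<B> x \<subseteq> appr_funs X \<and> \<B> x \<noteq> {} \<and>
        (\<forall>\<alpha>\<in>\<B> x. \<forall>\<beta>\<in>\<B> x. \<exists>\<gamma>\<in>\<B> x. \<forall>y\<in>X. max (\<alpha> y) (\<beta> y) \<le> \<gamma> y) \<and>
        \<A> x = {\<psi> \<in> appr_funs X. dominated_by X (\<B> x) \<psi>})"

definition locally_countably_generated :: "'a set \<Rightarrow> ('a \<Rightarrow> ('a \<Rightarrow> ennreal) set) \<Rightarrow> bool" where
  "locally_countably_generated X \<A> \<longleftrightarrow>
     (\<exists>\<B>. approach_basis X \<A> \<B> \<and> (\<forall>x\<in>X. countable (\<B> x)))"

text \<open>
  The center of a ball enters only through the function: \<open>appr_ball X \<phi> \<epsilon>\<close> with \<open>\<phi> \<in> \<A> x\<close> is the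
  ball with center x and radius \<open>\<epsilon>\<close>.
\<close>
definition appr_ball :: "'a set \<Rightarrow> ('a \<Rightarrow> ennreal) \<Rightarrow> real \<Rightarrow> 'a set" where
  "appr_ball X \<phi> \<epsilon> = {y \<in> X. \<phi> y < ennreal \<epsilon>}"

definition top_coreflection :: "'a set \<Rightarrow> ('a \<Rightarrow> ('a \<Rightarrow> ennreal) set) \<Rightarrow> 'a topology" where
  "top_coreflection X \<A> =
     topology (\<lambda>U. U \<subseteq> X \<and> (\<forall>x\<in>U. \<exists>\<phi>\<in>\<A> x. \<exists>\<epsilon>>0. appr_ball X \<phi> \<epsilon> \<subseteq> U))"

definition eps_converges_to ::
    "'a set \<Rightarrow> ('a \<Rightarrow> ('a \<Rightarrow> ennreal) set) \<Rightarrow> real \<Rightarrow> (nat \<Rightarrow> 'a) \<Rightarrow> 'a \<Rightarrow> bool" where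
  "eps_converges_to X \<A> \<epsilon> s x \<longleftrightarrow>
     x \<in> X \<and> (\<forall>\<phi>\<in>\<A> x. \<forall>\<^sub>F n in sequentially. s n \<in> appr_ball X \<phi> \<epsilon>)"

definition eps_convergent ::
    "'a set \<Rightarrow> ('a \<Rightarrow> ('a \<Rightarrow> ennreal) set) \<Rightarrow> real \<Rightarrow> (nat \<Rightarrow> 'a) \<Rightarrow> bool" where
  "eps_convergent X \<A> \<epsilon> s \<longleftrightarrow> (\<exists>x\<in>X. eps_converges_to X \<A> \<epsilon> s x)"

definition seq_lim_index ::
    "'a set \<Rightarrow> ('a \<Rightarrow> ('a \<Rightarrow> ennreal) set) \<Rightarrow> (nat \<Rightarrow> 'a) \<Rightarrow> 'a \<Rightarrow> ennreal" where
  "seq_lim_index X \<A> s x = (INF \<alpha>\<in>{\<alpha>. 0 < \<alpha> \<and> eps_converges_to X \<A> \<alpha> s x}. ennreal \<alpha>)"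

definition sequentially_complete :: "'a set \<Rightarrow> ('a \<Rightarrow> ('a \<Rightarrow> ennreal) set) \<Rightarrow> bool" where
  "sequentially_complete X \<A> \<longleftrightarrow>
     (\<forall>s. range s \<subseteq> X \<longrightarrow> (INF x\<in>X. seq_lim_index X \<A> s x) = 0 \<longrightarrow>
        (\<exists>x\<in>X. limitin (top_coreflection X \<A>) s x sequentially))"

definition eps_rel_seq_compact ::
    "'a set \<Rightarrow> ('a \<Rightarrow> ('a \<Rightarrow> ennreal) set) \<Rightarrow> real \<Rightarrow> 'a set \<Rightarrow> bool" where
  "eps_rel_seq_compact X \<A> \<epsilon> A \<longleftrightarrow>
     (\<forall>s. range s \<subseteq> A \<longrightarrow> (\<exists>r::nat \<Rightarrow> nat. strict_mono r \<and> eps_convergent X \<A> \<epsilon> (s \<circ> r)))"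

definition chi_rsc :: "'a set \<Rightarrow> ('a \<Rightarrow> ('a \<Rightarrow> ennreal) set) \<Rightarrow> 'a set \<Rightarrow> ennreal" where
  "chi_rsc X \<A> A = (INF \<alpha>\<in>{\<alpha>. 0 < \<alpha> \<and> eps_rel_seq_compact X \<A> \<alpha> A}. ennreal \<alpha>)"

definition eps_rel_compact ::
    "'a set \<Rightarrow> ('a \<Rightarrow> ('a \<Rightarrow> ennreal) set) \<Rightarrow> real \<Rightarrow> 'a set \<Rightarrow> bool" where
  "eps_rel_compact X \<A> \<epsilon> A \<longleftrightarrow>
     (\<forall>\<Phi>\<in>Pi X \<A>. \<exists>F. finite F \<and> F \<subseteq> X \<and> A \<subseteq> (\<Union>x\<in>F. appr_ball X (\<Phi> x) \<epsilon>))"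

definition chi_rc :: "'a set \<Rightarrow> ('a \<Rightarrow> ('a \<Rightarrow> ennreal) set) \<Rightarrow> 'a set \<Rightarrow> ennreal" where
  "chi_rc X \<A> A = (INF \<alpha>\<in>{\<alpha>. 0 < \<alpha> \<and> eps_rel_compact X \<A> \<alpha> A}. ennreal \<alpha>)"

definition eps_Lindelof :: "'a set \<Rightarrow> ('a \<Rightarrow> ('a \<Rightarrow> ennreal) set) \<Rightarrow> real \<Rightarrow> bool" where
  "eps_Lindelof X \<A> \<epsilon> \<longleftrightarrow>
     (\<forall>\<Phi>\<in>Pi X \<A>. \<exists>C. countable C \<and> C \<subseteq> X \<and> X \<subseteq> (\<Union>x\<in>C. appr_ball X (\<Phi> x) \<epsilon>))"

definition chi_L :: "'a set \<Rightarrow> ('a \<Rightarrow> ('a \<Rightarrow> ennreal) set) \<Rightarrow> ennreal" where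
  "chi_L X \<A> = (INF \<alpha>\<in>{\<alpha>. 0 < \<alpha> \<and> eps_Lindelof X \<A> \<alpha>}. ennreal \<alpha>)"

definition rel_seq_compact :: "'a set \<Rightarrow> ('a \<Rightarrow> ('a \<Rightarrow> ennreal) set) \<Rightarrow> 'a set \<Rightarrow> bool" where
  "rel_seq_compact X \<A> A \<longleftrightarrow>
     (\<forall>s. range s \<subseteq> A \<longrightarrow>
        (\<exists>r::nat \<Rightarrow> nat. strict_mono r \<and>
           (\<exists>x\<in>X. limitin (top_coreflection X \<A>) (s \<circ> r) x sequentially)))"

context approach_space
begin

lemma openin_top_coreflection:
  "openin (top_coreflection X \<A>) U \<longleftrightarrow>
     U \<subseteq> X \<and> (\<forall>x\<in>U. \<exists>\<phi>\<in>\<A> x. \<exists>\<epsilon>>0. appr_ball X \<phi> \<epsilon> \<subseteq> U)"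
proof -
  let ?P = "\<lambda>U. U \<subseteq> X \<and> (\<forall>x\<in>U. \<exists>\<phi>\<in>\<A> x. \<exists>\<epsilon>>0. appr_ball X \<phi> \<epsilon> \<subseteq> U)"
  have "?P (S \<inter> T)" if S: "?P S" and T: "?P T" for S T
  proof (intro conjI ballI)
    show "S \<inter> T \<subseteq> X" using S by blast
    fix x assume x: "x \<in> S \<inter> T"
    obtain \<phi> e where 1: "\<phi> \<in> \<A> x" "e > 0" "appr_ball X \<phi> e \<subseteq> S" using S x by blast
    obtain \<psi> d where 2: "\<psi> \<in> \<A> x" "d > 0" "appr_ball X \<psi> d \<subseteq> T" using T x by blast
    have "appr_ball X (\<lambda>y\<in>X. max (\<phi> y) (\<psi> y)) (min e d) \<subseteq> appr_ball X \<phi> e \<inter> appr_ball X \<psi> d"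
      by (auto simp: appr_ball_def elim!: order_less_le_trans intro!: ennreal_leI)
    moreover have "(\<lambda>y\<in>X. max (\<phi> y) (\<psi> y)) \<in> \<A> x" using max_closed 1 2 x S by blast
    moreover have "min e d > 0" using 1 2 by simp
    ultimately show "\<exists>\<phi>\<in>\<A> x. \<exists>\<epsilon>>0. appr_ball X \<phi> \<epsilon> \<subseteq> S \<inter> T"
      using 1(3) 2(3) by (meson Int_mono subset_trans)
  qed
  moreover have "?P (\<Union>K)" if K: "\<And>S. S \<in> K \<Longrightarrow> ?P S" for K
  proof (intro conjI ballI)
    show "\<Union>K \<subseteq> X" using K by blast
    fix x assume "x \<in> \<Union>K"
    then obtain S where S: "S \<in> K" "x \<in> S" by blast
    then obtain \<phi> e where "\<phi> \<in> \<A> x" "e > 0" "appr_ball X \<phi> e \<subseteq> S" using K by blast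
    moreover have "S \<subseteq> \<Union>K" using S by blast
    ultimately show "\<exists>\<phi>\<in>\<A> x. \<exists>\<epsilon>>0. appr_ball X \<phi> \<epsilon> \<subseteq> \<Union>K" by (meson subset_trans)
  qed
  ultimately have "istopology ?P" unfolding istopology_def by presburger
  then show ?thesis by (simp add: top_coreflection_def topology_inverse')
qed

lemma topspace_top_coreflection: "topspace (top_coreflection X \<A>) = X"
proof -
  have "openin (top_coreflection X \<A>) X"
    unfolding openin_top_coreflection
  proof (intro conjI ballI)
    fix x assume "x \<in> X"
    then obtain \<phi> where "\<phi> \<in> \<A> x" using nonempty by blast
    moreover have "appr_ball X \<phi> 1 \<subseteq> X" by (auto simp: appr_ball_def)
    ultimately show "\<exists>\<phi>\<in>\<A> x. \<exists>\<epsilon>>0. appr_ball X \<phi> \<epsilon> \<subseteq> X" using zero_less_one by blast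
  qed simp
  then show ?thesis
    by (metis openin_subset openin_topspace openin_top_coreflection subset_antisym)
qed

text \<open>The balls form a neighbourhood base at their centers.\<close>
lemma top_coreflection_nhds:
  assumes x: "x \<in> X" and S: "S \<subseteq> X"
  shows "(\<exists>U. openin (top_coreflection X \<A>) U \<and> x \<in> U \<and> U \<subseteq> S) \<longleftrightarrow>
         (\<exists>\<phi>\<in>\<A> x. \<exists>\<epsilon>>0. appr_ball X \<phi> \<epsilon> \<subseteq> S)"
proof
  assume "\<exists>U. openin (top_coreflection X \<A>) U \<and> x \<in> U \<and> U \<subseteq> S"
  then show "\<exists>\<phi>\<in>\<A> x. \<exists>\<epsilon>>0. appr_ball X \<phi> \<epsilon> \<subseteq> S"
    unfolding openin_top_coreflection by (meson subset_trans)
next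
  assume R: "\<exists>\<phi>\<in>\<A> x. \<exists>\<epsilon>>0. appr_ball X \<phi> \<epsilon> \<subseteq> S"
  define U where "U = {z \<in> X. \<exists>\<phi>\<in>\<A> z. \<exists>\<epsilon>>0. appr_ball X \<phi> \<epsilon> \<subseteq> S}"
  have "U \<subseteq> S"
  proof
    fix z assume "z \<in> U"
    then obtain \<phi> e where z: "z \<in> X" "\<phi> \<in> \<A> z" "e > 0" "appr_ball X \<phi> e \<subseteq> S"
      unfolding U_def by blast
    then have "z \<in> appr_ball X \<phi> e" using A1[of z \<phi>] by (simp add: appr_ball_def)
    with z show "z \<in> S" by blast
  qed
  moreover have "openin (top_coreflection X \<A>) U"
    unfolding openin_top_coreflection
  proof (intro conjI ballI)
    show "U \<subseteq> X" by (auto simp: U_def)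
    fix z assume "z \<in> U"
    then obtain \<phi> e where z: "z \<in> X" "\<phi> \<in> \<A> z" "e > 0" "appr_ball X \<phi> e \<subseteq> S"
      unfolding U_def by blast
    have "ennreal e < \<infinity>" by simp
    then obtain \<Phi> where \<Phi>: "\<Phi> \<in> Pi X \<A>"
      and tri: "\<And>y w. y \<in> X \<Longrightarrow> w \<in> X \<Longrightarrow> min (\<phi> y) (ennreal e) \<le> \<Phi> z w + \<Phi> w y"
      using A3[OF z(1,2)] by blast
    have "appr_ball X (\<Phi> z) (e/2) \<subseteq> U"
    proof
      fix w assume w: "w \<in> appr_ball X (\<Phi> z) (e/2)"
      then have wX: "w \<in> X" and 1: "\<Phi> z w < ennreal (e/2)" by (auto simp: appr_ball_def)
      have "appr_ball X (\<Phi> w) (e/2) \<subseteq> appr_ball X \<phi> e"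
      proof
        fix y assume "y \<in> appr_ball X (\<Phi> w) (e/2)"
        then have y: "y \<in> X" and 2: "\<Phi> w y < ennreal (e/2)" by (auto simp: appr_ball_def)
        have "min (\<phi> y) (ennreal e) < ennreal (e/2) + ennreal (e/2)"
          using tri[OF y wX] add_strict_mono[OF 1 2] by (rule order_le_less_trans)
        also have "\<dots> = ennreal e" using z(3) by (simp flip: ennreal_plus)
        finally show "y \<in> appr_ball X \<phi> e" using y by (auto simp: appr_ball_def min_def split: if_splits)
      qed
      moreover have "\<Phi> w \<in> \<A> w" using \<Phi> wX by blast
      moreover have "e/2 > 0" using z(3) by simp
      ultimately show "w \<in> U" using wX z(4) unfolding U_def by blast
    qed
    moreover have "\<Phi> z \<in> \<A> z" using \<Phi> z by blast
    moreover have "e/2 > 0" using z(3) by simp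
    ultimately show "\<exists>\<phi>\<in>\<A> z. \<exists>\<epsilon>>0. appr_ball X \<phi> \<epsilon> \<subseteq> U" by blast
  qed
  moreover have "x \<in> U" using R x by (simp add: U_def)
  ultimately show "\<exists>U. openin (top_coreflection X \<A>) U \<and> x \<in> U \<and> U \<subseteq> S" by blast
qed

end

end

theory Submission
  imports Defs "HOL-Library.Diagonal_Subsequence"
begin

text \<open>
  For the first inequality, if no subsequence of a sequence \<open>s\<close> converges to \<open>x\<close> with error slightly
  above \<open>\<alpha>\<close>, then a countable basis at \<open>x\<close> yields some \<open>\<phi> \<in> \<A> x\<close> whose \<open>\<alpha>\<close>-ball contains only
  finitely many terms of \<open>s\<close>; finitely many such balls cannot cover the range of \<open>s\<close>.
  For the second, split each \<open>\<Phi> x\<close> by (A3) and apply the Lindelof property to the split functions,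
  getting countably many centers; a sequence in \<open>A\<close> escaping ever more of the corresponding
  \<open>\<Phi>\<close>-balls of radius \<open>\<alpha> + \<beta>\<close> cannot have an \<open>\<alpha>\<close>-convergent subsequence, since its limit point
  lies within \<open>\<beta>\<close> of one of the centers.
  For the last part, a diagonal subsequence is \<open>\<epsilon>\<close>-convergent for every \<open>\<epsilon> > 0\<close>, with limit points
  depending on \<open>\<epsilon>\<close>, and sequential completeness makes it converge.
\<close>

section \<open>Stability of \<epsilon>-convergence and access to the infima\<close>

lemma eps_converges_to_mono:
  assumes "eps_converges_to X \<A> \<alpha> s x" "\<alpha> \<le> \<beta>"
  shows "eps_converges_to X \<A> \<beta> s x"
proof -
  have "appr_ball X \<phi> \<alpha> \<subseteq> appr_ball X \<phi> \<beta>" for \<phi> :: "'a \<Rightarrow> ennreal"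
    using ennreal_leI[OF assms(2)] by (auto simp: appr_ball_def)
  with assms(1) show ?thesis
    unfolding eps_converges_to_def by (blast intro: eventually_mono)
qed

lemma eps_converges_to_subseq:
  assumes "eps_converges_to X \<A> \<alpha> s x" "strict_mono r"
  shows "eps_converges_to X \<A> \<alpha> (s \<circ> r) x"
  using assms eventually_subseq[OF assms(2)] unfolding eps_converges_to_def by auto

text \<open>A diagonal sequence is a subsequence of each stage only from some index on; this lets
  its initial terms be dropped.\<close>

lemma eps_converges_to_offset:
  "eps_converges_to X \<A> \<alpha> (s \<circ> (+) k) x \<longleftrightarrow> eps_converges_to X \<A> \<alpha> s x"
  unfolding eps_converges_to_def
  using eventually_sequentially_seg[of "\<lambda>n. s n \<in> appr_ball X \<phi> \<alpha>" k for \<phi>]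
  by (simp add: add.commute)

lemma chi_rsc_le: "0 < \<alpha> \<Longrightarrow> eps_rel_seq_compact X \<A> \<alpha> A \<Longrightarrow> chi_rsc X \<A> A \<le> ennreal \<alpha>"
  unfolding chi_rsc_def by (rule INF_lower) simp

lemma chi_rc_le: "0 < \<alpha> \<Longrightarrow> eps_rel_compact X \<A> \<alpha> A \<Longrightarrow> chi_rc X \<A> A \<le> ennreal \<alpha>"
  unfolding chi_rc_def by (rule INF_lower) simp

lemma chi_rsc_lessE:
  assumes "chi_rsc X \<A> A < c"
  obtains \<alpha> where "0 < \<alpha>" "eps_rel_seq_compact X \<A> \<alpha> A" "ennreal \<alpha> < c"
  using assms unfolding chi_rsc_def INF_less_iff by blast

lemma chi_L_lessE:
  assumes "chi_L X \<A> < c"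
  obtains \<alpha> where "0 < \<alpha>" "eps_Lindelof X \<A> \<alpha>" "ennreal \<alpha> < c"
  using assms unfolding chi_L_def INF_less_iff by blast

section \<open>Countable local bases and extraction of subsequences\<close>

context approach_space
begin

text \<open>Running maxima of an enumeration of a countable basis at \<open>x\<close> stay in
  \<open>\<A> x\<close> and lie above the enumerated functions, so they inherit the approximation
  property. Being a chain, they let one index control all later ones.\<close>

lemma countable_basis_chain:
  assumes "locally_countably_generated X \<A>" and x: "x \<in> X"
  obtains m :: "nat \<Rightarrow> 'a \<Rightarrow> ennreal"
  where "\<And>k. m k \<in> \<A> x"
    and "\<And>k l y. k \<le> l \<Longrightarrow> y \<in> X \<Longrightarrow> m k y \<le> m l y"
    and "\<And>\<phi> \<epsilon> N. \<phi> \<in> \<A> x \<Longrightarrow> 0 < \<epsilon> \<Longrightarrow> N < \<infinity> \<Longrightarrow>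
           \<exists>k. \<forall>y\<in>X. min (\<phi> y) N \<le> m k y + ennreal \<epsilon>"
proof -
  obtain \<B> where \<B>: "approach_basis X \<A> \<B>" "\<forall>x\<in>X. countable (\<B> x)"
    using assms(1) unfolding locally_countably_generated_def by blast
  have sub: "\<B> x \<subseteq> appr_funs X" and ne: "\<B> x \<noteq> {}"
    and eq: "\<A> x = {\<psi> \<in> appr_funs X. dominated_by X (\<B> x) \<psi>}"
    using \<B>(1) x unfolding approach_basis_def by blast+
  define b where "b = from_nat_into (\<B> x)"
  have range_b: "range b = \<B> x"
    unfolding b_def using ne \<B>(2) x by (simp add: range_from_nat_into)
  have bA: "b k \<in> \<A> x" for k
  proof -
    have "b k \<in> \<B> x" using range_b by blast
    moreover have "\<forall>y\<in>X. min (b k y) N \<le> b k y + ennreal e" for e N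
      by (simp add: add_increasing2 min.coboundedI1)
    ultimately show ?thesis using sub unfolding eq dominated_by_def by blast
  qed
  define m where "m = rec_nat (b 0) (\<lambda>k f. \<lambda>y\<in>X. max (f y) (b (Suc k) y))"
  have m_0: "m 0 = b 0" and m_Suc: "m (Suc k) = (\<lambda>y\<in>X. max (m k y) (b (Suc k) y))" for k
    by (simp_all add: m_def)
  have mA: "m k \<in> \<A> x" for k
    by (induction k) (simp_all only: m_0 m_Suc bA max_closed[OF x])
  have b_le_m: "b k y \<le> m k y" if "y \<in> X" for k y
    using that by (cases k) (simp_all add: m_0 m_Suc)
  have mono: "m k y \<le> m l y" if "k \<le> l" "y \<in> X" for k l y
    using that(1) by (induction l rule: dec_induct) (auto simp: m_Suc that(2) intro: max.coboundedI1)
  have dom: "\<exists>k. \<forall>y\<in>X. min (\<phi> y) N \<le> m k y + ennreal \<epsilon>"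
    if \<phi>: "\<phi> \<in> \<A> x" "0 < \<epsilon>" "N < \<infinity>" for \<phi> \<epsilon> N
  proof -
    have "\<exists>\<beta>\<in>\<B> x. \<forall>y\<in>X. min (\<phi> y) N \<le> \<beta> y + ennreal \<epsilon>"
      using \<phi> unfolding eq dominated_by_def by blast
    then obtain k where "\<forall>y\<in>X. min (\<phi> y) N \<le> b k y + ennreal \<epsilon>"
      unfolding range_b[symmetric] by (elim bexE rangeE) simp
    then have "\<forall>y\<in>X. min (\<phi> y) N \<le> m k y + ennreal \<epsilon>"
      using b_le_m by (meson add_right_mono order_trans)
    then show ?thesis by blast
  qed
  show ?thesis by (rule that[of m]) (fact mA mono dom)+
qed

text \<open>Increasing indices \<open>r k\<close> with \<open>s (r k)\<close> in the \<alpha>-ball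
  of the k-th chain function put the tail from k on into that ball. A general \<phi> is approximated
  by the chain only up to a positive error, which the gap \<beta> - \<alpha> pays for.\<close>

lemma frequently_in_balls_imp_subseq:
  assumes lcg: "locally_countably_generated X \<A>" and x: "x \<in> X"
    and freq: "\<And>\<phi>. \<phi> \<in> \<A> x \<Longrightarrow> \<exists>\<^sub>F n in sequentially. s n \<in> appr_ball X \<phi> \<alpha>"
    and "0 < \<alpha>" "\<alpha> < \<beta>"
  obtains r :: "nat \<Rightarrow> nat" where "strict_mono r" "eps_converges_to X \<A> \<beta> (s \<circ> r) x"
proof -
  obtain m :: "nat \<Rightarrow> 'a \<Rightarrow> ennreal" where mA: "\<And>k. m k \<in> \<A> x"
    and mono: "\<And>k l y. k \<le> l \<Longrightarrow> y \<in> X \<Longrightarrow> m k y \<le> m l y"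
    and dom: "\<And>\<phi> \<epsilon> N. \<phi> \<in> \<A> x \<Longrightarrow> 0 < \<epsilon> \<Longrightarrow> N < \<infinity> \<Longrightarrow>
           \<exists>k. \<forall>y\<in>X. min (\<phi> y) N \<le> m k y + ennreal \<epsilon>"
    using countable_basis_chain[OF lcg x] by blast
  have ex: "\<exists>n>i. s n \<in> appr_ball X (m k) \<alpha>" for i k
    using freq[OF mA, of k] unfolding frequently_sequentially by (meson Suc_le_lessD)
  have "\<exists>r. \<forall>k. s (r k) \<in> appr_ball X (m k) \<alpha> \<and> r k < r (Suc k)"
    by (rule dependent_nat_choice[of "\<lambda>k n. s n \<in> appr_ball X (m k) \<alpha>" "\<lambda>_. (<)"]) (use ex in blast)+
  then obtain r where r: "\<And>k. s (r k) \<in> appr_ball X (m k) \<alpha>" "\<And>k. r k < r (Suc k)"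
    by blast
  have "\<forall>\<^sub>F j in sequentially. s (r j) \<in> appr_ball X \<phi> \<beta>" if \<phi>: "\<phi> \<in> \<A> x" for \<phi>
  proof -
    \<comment> \<open>Truncating at \<beta> is harmless: a truncated value below \<beta> is the
      value of \<phi> itself.\<close>
    obtain k where k: "\<forall>y\<in>X. min (\<phi> y) (ennreal \<beta>) \<le> m k y + ennreal (\<beta> - \<alpha>)"
      using dom[OF \<phi>, of "\<beta> - \<alpha>" "ennreal \<beta>"] \<open>\<alpha> < \<beta>\<close> by auto
    have "s (r j) \<in> appr_ball X \<phi> \<beta>" if "k \<le> j" for j
    proof -
      have y: "s (r j) \<in> X" and lt: "m j (s (r j)) < ennreal \<alpha>"
        using r(1)[of j] by (auto simp: appr_ball_def)
      have "min (\<phi> (s (r j))) (ennreal \<beta>) \<le> m k (s (r j)) + ennreal (\<beta> - \<alpha>)"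
        using k y by blast
      also have "\<dots> \<le> m j (s (r j)) + ennreal (\<beta> - \<alpha>)"
        using mono[OF that y] by (rule add_right_mono)
      also have "\<dots> < ennreal \<alpha> + ennreal (\<beta> - \<alpha>)"
        using lt by (simp add: ennreal_add_left_cancel_less add.commute)
      also have "\<dots> = ennreal \<beta>"
        using \<open>0 < \<alpha>\<close> \<open>\<alpha> < \<beta>\<close> by (simp flip: ennreal_plus)
      finally show ?thesis
        using y by (auto simp: appr_ball_def min_def split: if_splits)
    qed
    then show ?thesis unfolding eventually_sequentially by blast
  qed
  then have "eps_converges_to X \<A> \<beta> (s \<circ> r) x"
    using x by (simp add: eps_converges_to_def)
  moreover have "strict_mono r" using r(2) by (simp add: strict_mono_Suc_iff)
  ultimately show ?thesis using that by blast
qed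

section \<open>Covering compactness versus sequential compactness at fixed radii\<close>

lemma eps_rel_compact_imp_eps_rel_seq_compact:
  assumes lcg: "locally_countably_generated X \<A>"
    and rc: "eps_rel_compact X \<A> \<alpha> A" and "0 < \<alpha>" "\<alpha> < \<beta>"
  shows "eps_rel_seq_compact X \<A> \<beta> A"
  unfolding eps_rel_seq_compact_def
proof (intro allI impI)
  fix s :: "nat \<Rightarrow> 'a" assume s: "range s \<subseteq> A"
  show "\<exists>r::nat \<Rightarrow> nat. strict_mono r \<and> eps_convergent X \<A> \<beta> (s \<circ> r)"
  proof (rule ccontr)
    assume no: "\<not> ?thesis"
    have "\<exists>\<phi>\<in>\<A> x. \<forall>\<^sub>F n in sequentially. s n \<notin> appr_ball X \<phi> \<alpha>" if x: "x \<in> X" for x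
    proof (rule ccontr)
      assume "\<not> ?thesis"
      then have "\<exists>\<^sub>F n in sequentially. s n \<in> appr_ball X \<phi> \<alpha>" if "\<phi> \<in> \<A> x" for \<phi>
        using that unfolding frequently_def by blast
      then obtain r where "strict_mono r" "eps_converges_to X \<A> \<beta> (s \<circ> r) x"
        using frequently_in_balls_imp_subseq[OF lcg x _ assms(3,4)] by blast
      with no x show False unfolding eps_convergent_def by blast
    qed
    \<comment> \<open>One such function at each point gives a family whose balls each miss all but
      finitely many terms of \<open>s\<close>; compactness is applied to this family.\<close>
    then obtain \<Phi> where \<Phi>: "\<And>x. x \<in> X \<Longrightarrow> \<Phi> x \<in> \<A> x"
      and out: "\<And>x. x \<in> X \<Longrightarrow> \<forall>\<^sub>F n in sequentially. s n \<notin> appr_ball X (\<Phi> x) \<alpha>"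
      by metis
    from \<Phi> have "\<Phi> \<in> Pi X \<A>" by blast
    with rc have "\<exists>F. finite F \<and> F \<subseteq> X \<and> A \<subseteq> (\<Union>x\<in>F. appr_ball X (\<Phi> x) \<alpha>)"
      unfolding eps_rel_compact_def by (rule bspec)
    then obtain F where F: "finite F" "F \<subseteq> X" "A \<subseteq> (\<Union>x\<in>F. appr_ball X (\<Phi> x) \<alpha>)"
      by blast
    have "\<forall>\<^sub>F n in sequentially. \<forall>x\<in>F. s n \<notin> appr_ball X (\<Phi> x) \<alpha>"
      using F(1,2) out by (intro eventually_ball_finite) auto
    then obtain n where "\<forall>x\<in>F. s n \<notin> appr_ball X (\<Phi> x) \<alpha>"
      using eventually_happens'[OF sequentially_bot] by blast
    with F(3) s show False by blast
  qed
qed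

lemma eps_rel_seq_compact_Lindelof_imp_eps_rel_compact:
  assumes AX: "A \<subseteq> X" and rsc: "eps_rel_seq_compact X \<A> \<alpha> A"
    and L: "eps_Lindelof X \<A> \<beta>" and pos: "0 < \<alpha>" "0 < \<beta>"
  shows "eps_rel_compact X \<A> (\<alpha> + \<beta>) A"
  unfolding eps_rel_compact_def
proof
  fix \<Phi> assume \<Phi>: "\<Phi> \<in> Pi X \<A>"
  \<comment> \<open>The splitting family depends on \<open>x\<close>. Truncation at \<alpha> +
    \<beta> loses nothing, since only values below that radius matter.\<close>
  have "\<exists>\<Psi>\<in>Pi X \<A>. \<forall>y\<in>X. \<forall>z\<in>X. min (\<Phi> x y) (ennreal (\<alpha> + \<beta>)) \<le> \<Psi> x z + \<Psi> z y"
    if "x \<in> X" for x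
    using A3[OF that Pi_mem[OF \<Phi> that], of "ennreal (\<alpha> + \<beta>)"] that by simp
  then obtain \<Psi> where \<Psi>: "\<And>x. x \<in> X \<Longrightarrow> \<Psi> x \<in> Pi X \<A>"
    and tri: "\<And>x y z. x \<in> X \<Longrightarrow> y \<in> X \<Longrightarrow> z \<in> X \<Longrightarrow>
                min (\<Phi> x y) (ennreal (\<alpha> + \<beta>)) \<le> \<Psi> x x z + \<Psi> x z y"
    by metis
  \<comment> \<open>\<open>\<Psi> x x\<close> controls the leg from the center \<open>x\<close> to
    an intermediate point, and the Lindelof property is applied to this diagonal family. The other
    leg, \<open>\<Psi> x z\<close>, is used later at the limit point.\<close>
  have "(\<lambda>x. \<Psi> x x) \<in> Pi X \<A>" using \<Psi> by blast
  with L obtain C where C: "countable C" "C \<subseteq> X" "X \<subseteq> (\<Union>x\<in>C. appr_ball X (\<Psi> x x) \<beta>)"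
    unfolding eps_Lindelof_def by (auto dest!: bspec)
  show "\<exists>F. finite F \<and> F \<subseteq> X \<and> A \<subseteq> (\<Union>x\<in>F. appr_ball X (\<Phi> x) (\<alpha> + \<beta>))"
  proof (rule ccontr)
    assume no: "\<not> ?thesis"
    \<comment> \<open>If \<open>C\<close> were empty, so would be \<open>X\<close> and
      \<open>A\<close>, and the empty \<open>F\<close> would cover \<open>A\<close>. Nonemptiness
      makes \<open>from_nat_into C\<close> an enumeration of \<open>C\<close>.\<close>
    have "C \<noteq> {}" using C(3) AX no by auto
    define c where "c = from_nat_into C"
    have range_c: "range c = C"
      unfolding c_def using C(1) \<open>C \<noteq> {}\<close> by (simp add: range_from_nat_into)
    have "\<exists>y\<in>A. \<forall>i\<le>n. y \<notin> appr_ball X (\<Phi> (c i)) (\<alpha> + \<beta>)" for n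
    proof -
      have "finite (c ` {..n})" "c ` {..n} \<subseteq> X" using range_c C(2) by auto
      then have "\<not> A \<subseteq> (\<Union>x\<in>c ` {..n}. appr_ball X (\<Phi> x) (\<alpha> + \<beta>))" using no by blast
      then show ?thesis by auto
    qed
    then obtain s where sA: "\<And>n. s n \<in> A"
      and out: "\<And>n i. i \<le> n \<Longrightarrow> s n \<notin> appr_ball X (\<Phi> (c i)) (\<alpha> + \<beta>)"
      by metis
    then have "range s \<subseteq> A" by blast
    with rsc obtain r x where r: "strict_mono r"
      and x: "x \<in> X" and conv: "eps_converges_to X \<A> \<alpha> (s \<circ> r) x"
      unfolding eps_rel_seq_compact_def eps_convergent_def by metis
    obtain i where i: "x \<in> appr_ball X (\<Psi> (c i) (c i)) \<beta>"
      using C(3) x range_c by blast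
    have ci: "c i \<in> X" using range_c C(2) by blast
    have "\<Psi> (c i) x \<in> \<A> x" using \<Psi>[OF ci] x by blast
    with conv have "\<forall>\<^sub>F n in sequentially. s (r n) \<in> appr_ball X (\<Psi> (c i) x) \<alpha>"
      unfolding eps_converges_to_def by simp
    then have "\<forall>\<^sub>F n in sequentially. s (r n) \<in> appr_ball X (\<Psi> (c i) x) \<alpha> \<and> i \<le> n"
      using eventually_ge_at_top by (rule eventually_conj)
    then obtain n where n: "s (r n) \<in> appr_ball X (\<Psi> (c i) x) \<alpha>" "i \<le> n"
      using eventually_happens'[OF sequentially_bot] by blast
    have y: "s (r n) \<in> X" using sA AX by blast
    \<comment> \<open>The leg from \<open>c i\<close> to \<open>x\<close> is below \<beta> by the
      cover, the leg from \<open>x\<close> to the term below \<alpha> by convergence.\<close>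
    have "min (\<Phi> (c i) (s (r n))) (ennreal (\<alpha> + \<beta>)) \<le> \<Psi> (c i) (c i) x + \<Psi> (c i) x (s (r n))"
      by (rule tri[OF ci y x])
    also have "\<dots> < ennreal \<beta> + ennreal \<alpha>"
      using i n(1) by (intro add_strict_mono) (auto simp: appr_ball_def)
    also have "\<dots> = ennreal (\<alpha> + \<beta>)" using pos by (simp add: add.commute)
    finally have "s (r n) \<in> appr_ball X (\<Phi> (c i)) (\<alpha> + \<beta>)"
      using y by (auto simp: appr_ball_def min_def split: if_splits)
    \<comment> \<open>Since \<open>n \<le> r n\<close>, the center \<open>c i\<close> is among those
      whose balls \<open>s (r n)\<close> was chosen to avoid.\<close>
    moreover have "i \<le> r n" using n(2) seq_suble[OF r, of n] by linarith
    ultimately show False using out by blast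
  qed
qed

section \<open>From fixed radii to the indices\<close>

text \<open>The radius grows strictly when passing to sequences, but by an arbitrarily small amount,
  which the infimum does not see.\<close>

lemma chi_rsc_le_chi_rc:
  assumes "locally_countably_generated X \<A>"
  shows "chi_rsc X \<A> A \<le> chi_rc X \<A> A"
  unfolding chi_rc_def
proof (rule INF_greatest)
  fix \<alpha> assume "\<alpha> \<in> {\<alpha>. 0 < \<alpha> \<and> eps_rel_compact X \<A> \<alpha> A}"
  then have \<alpha>: "0 < \<alpha>" "eps_rel_compact X \<A> \<alpha> A" by auto
  show "chi_rsc X \<A> A \<le> ennreal \<alpha>"
  proof (rule ennreal_le_epsilon)
    fix e :: real assume e: "0 < e"
    then have "eps_rel_seq_compact X \<A> (\<alpha> + e) A"
      using eps_rel_compact_imp_eps_rel_seq_compact[OF assms \<alpha>(2,1)] by simp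
    then have "chi_rsc X \<A> A \<le> ennreal (\<alpha> + e)" using \<alpha>(1) e by (intro chi_rsc_le) auto
    then show "chi_rsc X \<A> A \<le> ennreal \<alpha> + ennreal e" using \<alpha>(1) e by simp
  qed
qed

lemma chi_rc_le_chi_rsc_plus_chi_L:
  assumes "A \<subseteq> X"
  shows "chi_rc X \<A> A \<le> chi_rsc X \<A> A + chi_L X \<A>"
proof (rule ennreal_le_epsilon)
  fix e :: real
  assume fin: "chi_rsc X \<A> A + chi_L X \<A> < top" and e: "0 < e"
  then have e2: "0 < ennreal (e/2)" by simp
  \<comment> \<open>Adding a positive number is a strict increase only for finite values;
    \<open>fin\<close> makes both summands finite.\<close>
  have "chi_rsc X \<A> A < chi_rsc X \<A> A + ennreal (e/2)"
    using fin e2 ennreal_add_left_cancel_less[of "chi_rsc X \<A> A" 0 "ennreal (e/2)"] by auto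
  then obtain \<alpha> where \<alpha>: "0 < \<alpha>" "eps_rel_seq_compact X \<A> \<alpha> A"
      "ennreal \<alpha> < chi_rsc X \<A> A + ennreal (e/2)"
    by (rule chi_rsc_lessE)
  have "chi_L X \<A> < chi_L X \<A> + ennreal (e/2)"
    using fin e2 ennreal_add_left_cancel_less[of "chi_L X \<A>" 0 "ennreal (e/2)"] by auto
  then obtain \<beta> where \<beta>: "0 < \<beta>" "eps_Lindelof X \<A> \<beta>"
      "ennreal \<beta> < chi_L X \<A> + ennreal (e/2)"
    by (rule chi_L_lessE)
  have "eps_rel_compact X \<A> (\<alpha> + \<beta>) A"
    by (rule eps_rel_seq_compact_Lindelof_imp_eps_rel_compact[OF assms \<alpha>(2) \<beta>(2) \<alpha>(1) \<beta>(1)])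
  then have "chi_rc X \<A> A \<le> ennreal (\<alpha> + \<beta>)" using \<alpha>(1) \<beta>(1) by (intro chi_rc_le) auto
  also have "\<dots> = ennreal \<alpha> + ennreal \<beta>" using \<alpha>(1) \<beta>(1) by simp
  also have "\<dots> \<le> (chi_rsc X \<A> A + ennreal (e/2)) + (chi_L X \<A> + ennreal (e/2))"
    using \<alpha>(3) \<beta>(3) by (intro add_mono) auto
  also have "\<dots> = chi_rsc X \<A> A + chi_L X \<A> + (ennreal (e/2) + ennreal (e/2))"
    by (simp add: ac_simps)
  also have "ennreal (e/2) + ennreal (e/2) = ennreal e" using e by (simp flip: ennreal_plus)
  finally show "chi_rc X \<A> A \<le> chi_rsc X \<A> A + chi_L X \<A> + ennreal e" .
qed

section \<open>The topological coreflection and sequential completeness\<close>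

text \<open>By \<open>top_coreflection_nhds\<close>, each ball contains an open neighbourhood of its
  center, even if the ball itself is not open.\<close>

lemma limitin_imp_eps_converges_to:
  assumes lim: "limitin (top_coreflection X \<A>) s x sequentially" and "0 < \<epsilon>"
  shows "eps_converges_to X \<A> \<epsilon> s x"
  unfolding eps_converges_to_def
proof (intro conjI ballI)
  show x: "x \<in> X" using lim limitin_topspace topspace_top_coreflection by metis
  fix \<phi> assume \<phi>: "\<phi> \<in> \<A> x"
  have "appr_ball X \<phi> \<epsilon> \<subseteq> X" by (auto simp: appr_ball_def)
  then obtain U where U: "openin (top_coreflection X \<A>) U" "x \<in> U" "U \<subseteq> appr_ball X \<phi> \<epsilon>"
    using top_coreflection_nhds[OF x, of "appr_ball X \<phi> \<epsilon>"] \<phi> \<open>0 < \<epsilon>\<close> by blast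
  with lim have "\<forall>\<^sub>F n in sequentially. s n \<in> U" unfolding limitin_def by blast
  then show "\<forall>\<^sub>F n in sequentially. s n \<in> appr_ball X \<phi> \<epsilon>"
    by (rule eventually_mono) (use U(3) in blast)
qed

text \<open>A topological limit of a subsequence is an \<epsilon>-limit for all \<epsilon> > 0 at
  once, so every positive radius is admissible.\<close>

lemma rel_seq_compact_imp_chi_rsc_eq_0:
  assumes "rel_seq_compact X \<A> A"
  shows "chi_rsc X \<A> A = 0"
proof -
  have "eps_rel_seq_compact X \<A> \<epsilon> A" if "0 < \<epsilon>" for \<epsilon>
    using assms limitin_imp_eps_converges_to[OF _ that]
    unfolding rel_seq_compact_def eps_rel_seq_compact_def eps_convergent_def by meson
  then have "chi_rsc X \<A> A \<le> 0 + ennreal \<epsilon>" if "0 < \<epsilon>" for \<epsilon>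
    using chi_rsc_le that by fastforce
  then have "chi_rsc X \<A> A \<le> 0" by (rule ennreal_le_epsilon)
  then show ?thesis by simp
qed

lemma chi_rsc_eq_0_imp_rel_seq_compact:
  assumes complete: "sequentially_complete X \<A>" and "A \<subseteq> X" and "chi_rsc X \<A> A = 0"
  shows "rel_seq_compact X \<A> A"
  unfolding rel_seq_compact_def
proof (intro allI impI)
  fix s :: "nat \<Rightarrow> 'a" assume s: "range s \<subseteq> A"
  have rsc: "\<exists>r::nat \<Rightarrow> nat. strict_mono r \<and> eps_convergent X \<A> \<epsilon> (t \<circ> r)"
    if "range t \<subseteq> A" "0 < \<epsilon>" for t \<epsilon>
  proof -
    have "chi_rsc X \<A> A < ennreal \<epsilon>" using assms(3) that(2) by simp
    then obtain \<alpha> where \<alpha>: "0 < \<alpha>" "eps_rel_seq_compact X \<A> \<alpha> A" "ennreal \<alpha> < ennreal \<epsilon>"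
      by (rule chi_rsc_lessE)
    then have "\<alpha> \<le> \<epsilon>" by (simp add: ennreal_less_iff)
    with \<alpha>(2) that(1) show ?thesis
      unfolding eps_rel_seq_compact_def eps_convergent_def by (meson eps_converges_to_mono)
  qed
  \<comment> \<open>Stage k refines any given subsequence to a 1/(k+1)-convergent one.\<close>
  interpret subseqs "\<lambda>k r. eps_convergent X \<A> (1 / real (Suc k)) (s \<circ> r)"
  proof
    fix k and r :: "nat \<Rightarrow> nat" assume "strict_mono r"
    show "\<exists>r'. strict_mono r' \<and> eps_convergent X \<A> (1 / real (Suc k)) (s \<circ> (r \<circ> r'))"
      using rsc[of "s \<circ> r" "1 / real (Suc k)"] s by (auto simp: comp_assoc)
  qed
  have conv: "eps_convergent X \<A> (1 / real (Suc k)) (s \<circ> diagseq)" for k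
  proof -
    \<comment> \<open>From index \<open>Suc k\<close> on, the diagonal is a subsequence of stage k
      and inherits its convergence; the shift is then undone.\<close>
    have "eps_convergent X \<A> (1 / real (Suc k)) (s \<circ> (diagseq \<circ> (+) (Suc k)))"
      by (rule diagseq_holds)
        (auto simp: eps_convergent_def simp flip: comp_assoc intro: eps_converges_to_subseq)
    then show ?thesis
      using eps_converges_to_offset[of X \<A> _ "s \<circ> diagseq" "Suc k"]
      by (auto simp: eps_convergent_def comp_assoc)
  qed
  \<comment> \<open>The limit point may change with k; the infimum over \<open>x\<close> absorbs
    this dependence.\<close>
  have "(INF x\<in>X. seq_lim_index X \<A> (s \<circ> diagseq) x) \<le> 0 + ennreal e" if e: "0 < e" for e
  proof -
    obtain k where k: "1 / real (Suc k) < e" using nat_approx_posE[OF e] by blast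
    obtain x where x: "x \<in> X" "eps_converges_to X \<A> (1 / real (Suc k)) (s \<circ> diagseq) x"
      using conv[of k] unfolding eps_convergent_def by blast
    have "(INF x\<in>X. seq_lim_index X \<A> (s \<circ> diagseq) x) \<le> seq_lim_index X \<A> (s \<circ> diagseq) x"
      using x(1) by (rule INF_lower)
    also have "\<dots> \<le> ennreal (1 / real (Suc k))"
      unfolding seq_lim_index_def using x(2) by (intro INF_lower) simp
    also have "\<dots> \<le> ennreal e" using k by (intro ennreal_leI) simp
    finally show ?thesis by simp
  qed
  then have "(INF x\<in>X. seq_lim_index X \<A> (s \<circ> diagseq) x) \<le> 0" by (rule ennreal_le_epsilon)
  then have "(INF x\<in>X. seq_lim_index X \<A> (s \<circ> diagseq) x) = 0" by simp
  moreover have "range (s \<circ> diagseq) \<subseteq> X" using s \<open>A \<subseteq> X\<close> by auto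
  ultimately have "\<exists>x\<in>X. limitin (top_coreflection X \<A>) (s \<circ> diagseq) x sequentially"
    using complete unfolding sequentially_complete_def by blast
  with subseq_diagseq show "\<exists>r::nat \<Rightarrow> nat. strict_mono r \<and>
      (\<exists>x\<in>X. limitin (top_coreflection X \<A>) (s \<circ> r) x sequentially)"
    by blast
qed

end

theorem theorem2p2:
  fixes X A :: "'a set" and \<A> :: "'a \<Rightarrow> ('a \<Rightarrow> ennreal) set"
  assumes "approach_space X \<A>"
    and "locally_countably_generated X \<A>"
    and "A \<subseteq> X"
  shows "(chi_rsc X \<A> A \<le> chi_rc X \<A> A \<and> chi_rc X \<A> A \<le> chi_rsc X \<A> A + chi_L X \<A>)
       \<and> (chi_L X \<A> = 0 \<longrightarrow> chi_rsc X \<A> A = chi_rc X \<A> A)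
       \<and> (chi_L X \<A> = 0 \<and> sequentially_complete X \<A> \<longrightarrow>
            (rel_seq_compact X \<A> A \<longleftrightarrow> chi_rsc X \<A> A = 0))"
proof -
  interpret approach_space X \<A> by fact
  have le: "chi_rsc X \<A> A \<le> chi_rc X \<A> A"
    using assms(2) by (rule chi_rsc_le_chi_rc)
  moreover have ge: "chi_rc X \<A> A \<le> chi_rsc X \<A> A + chi_L X \<A>"
    using assms(3) by (rule chi_rc_le_chi_rsc_plus_chi_L)
  moreover have "chi_rsc X \<A> A = chi_rc X \<A> A" if "chi_L X \<A> = 0"
    using le ge that by (simp add: order_antisym)
  moreover have "rel_seq_compact X \<A> A \<longleftrightarrow> chi_rsc X \<A> A = 0" if "sequentially_complete X \<A>"
    using rel_seq_compact_imp_chi_rsc_eq_0 chi_rsc_eq_0_imp_rel_seq_compact[OF that assms(3)] by blast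
  ultimately show ?thesis by blast
qed

end
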